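(* Let $n\in\mathbb N$ and let $k$ be a positive integer with $k\not\equiv0\pmod 3$; write $k=3q+\varepsilon$ with $q\in\mathbb N$ and $\varepsilon\in\{-1,1\}$. Then the map $$\varphi:C_{3,n}\to C_{3,\,k^2n+\frac{k^2-1}3},\qquad (-x-y,x,y)\mapsto\big(-\varepsilon(k(y+x)+q),\ \varepsilon kx,\ \varepsilon(ky+q)\big)$$ is well defined and injective.
   Context: $\mathbb N=\{0,1,2,\ldots\}$. A partition $\lambda$ is determined by its arm set $A^+(\lambda)=\{\lambda_i-i:1\le i\le s\}$ and leg set $L^+(\lambda)=\{\lambda^*_i-i:1\le i\le s\}$ ($s=\#\{i:\lambda_i\ge i\}$, $\lambda^*$ the conjugate); any two finite subsets of $\mathbb N$ of equal size are the leg and arm sets of a unique partition. For $c=(c_0,\ldots,c_{t-1})\in\mathbb Z^t$ with coordinate sum $0$, $\lambda_c$ is the partition with arm set $\{qt+j:0\le q<c_j\}$ and leg set $\{qt+t-j-1:0\le q<-c_j\}$ (over $0\le j\le t-1$), the $t$-core with characteristic vector $c$. $C_{t,n}=\{c\in\mathbb Z^t:\sum c_j=0,\ |\lambda_c|=n\}$. Elements of $C_{3,n}$ are written $(c_0,c_1,c_2)=(-x-y,x,y)$ with $x,y\in\mathbb Z$. *)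

theory Defs
  imports "HOL-Library.FuncSet"
begin

text \<open>A partition is the list of its positive parts in weakly decreasing order. Parts are
  numbered from 1 and all parts beyond the length of the list are 0.\<close>

definition is_partition :: "nat list \<Rightarrow> bool" where
  "is_partition l \<longleftrightarrow> sorted_wrt (\<ge>) l \<and> 0 \<notin> set l"

definition part :: "nat list \<Rightarrow> nat \<Rightarrow> nat" where
  "part l i = (if 1 \<le> i \<and> i \<le> length l then l ! (i - 1) else 0)"

definition conj_part :: "nat list \<Rightarrow> nat \<Rightarrow> nat" where
  "conj_part l j = card {i. 1 \<le> i \<and> i \<le> length l \<and> j \<le> part l i}"

definition diag_length :: "nat list \<Rightarrow> nat" where
  "diag_length l = card {i. 1 \<le> i \<and> i \<le> part l i}"

text \<open>For a partition and \<open>1 \<le> i \<le> diag_length l\<close> the subtractions below do not truncate.\<close>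

definition arm_set :: "nat list \<Rightarrow> nat set" where
  "arm_set l = {part l i - i | i. 1 \<le> i \<and> i \<le> diag_length l}"

definition leg_set :: "nat list \<Rightarrow> nat set" where
  "leg_set l = {conj_part l i - i | i. 1 \<le> i \<and> i \<le> diag_length l}"

text \<open>The description is meaningful when the coordinates of \<open>c\<close> sum to 0: the prescribed arm
  and leg sets then have the same finite cardinality.\<close>

definition core_partition :: "int list \<Rightarrow> nat list" where
  "core_partition c = (let t = length c in
     THE l. is_partition l
       \<and> arm_set l = {r * t + j | r j. j < t \<and> int r < c ! j}
       \<and> leg_set l = {r * t + t - j - 1 | r j. j < t \<and> int r < - (c ! j)})"

definition core_vectors :: "nat \<Rightarrow> nat \<Rightarrow> int list set" where
  "core_vectors t n = {c. length c = t \<and> sum_list c = 0 \<and> sum_list (core_partition c) = n}"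

definition phi :: "nat \<Rightarrow> nat \<Rightarrow> int \<Rightarrow> int list \<Rightarrow> int list" where
  "phi k q \<epsilon> c = (let x = c ! 1; y = c ! 2 in
     [- \<epsilon> * (int k * (y + x) + int q), \<epsilon> * int k * x, \<epsilon> * (int k * y + int q)])"

lemma phi_eq:
  "phi k q \<epsilon> [- x - y, x, y] =
     [- \<epsilon> * (int k * (y + x) + int q), \<epsilon> * int k * x, \<epsilon> * (int k * y + int q)]"
  by (simp add: phi_def)

lemma core_vectors_3_form:
  assumes "c \<in> core_vectors 3 n"
  shows "\<exists>!(x, y). c = [- x - y, x, y]"
proof -
  obtain a x y where c: "c = [a, x, y]"
    using assms by (auto simp: core_vectors_def numeral_3_eq_3 length_Suc_conv)
  with assms have "a = - x - y"
    by (simp add: core_vectors_def)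
  with c show ?thesis by auto
qed

lemma three_dvd_square_minus_1:
  fixes k :: nat
  assumes "k mod 3 \<noteq> 0"
  shows "3 dvd k\<^sup>2 - 1"
proof -
  have "3 dvd (k - 1) * (k + 1)"
  proof (cases "k mod 3 = 1")
    case True
    then have "3 dvd k - 1" by presburger
    then show ?thesis by simp
  next
    case False
    with assms have "3 dvd k + 1" by presburger
    then show ?thesis by (rule dvd_mult)
  qed
  moreover have "(k - 1) * (k + 1) = k\<^sup>2 - 1"
    by (simp add: algebra_simps power2_eq_square)
  ultimately show ?thesis by simp
qed

end

theory Submission
  imports Defs
begin

text \<open>Peeling off the first row and column of a partition removes the largest arm and the largest
  leg. By induction along this operation, a partition is determined by its arm and leg sets
  \<open>A\<close> and \<open>L\<close>, any two finite sets of equal size occur, and the size of the partition is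
  \<open>\<Sum>A + \<Sum>L + |A|\<close>. For the core with characteristic vector \<open>c\<close> this yields
  \<open>2 |\<lambda>\<^sub>c| = \<Sum>\<^sub>j (t c\<^sub>j\<^sup>2 + 2 j c\<^sub>j)\<close>; for \<open>t = 3\<close> and \<open>c = (-x-y, x, y)\<close> the size is
  \<open>3 (x\<^sup>2 + x y + y\<^sup>2) + x + 2 y\<close>, and the substitution defining the map transforms this quadratic
  polynomial as claimed.\<close>

section \<open>Partitions from arm and leg sets\<close>

text \<open>The partition with first arm \<open>a\<close>, first leg \<open>m\<close>, and \<open>l\<close> as the rest of its diagram;
  meaningful when \<open>length l \<le> m\<close> and \<open>part l 1 \<le> a\<close>.\<close>

definition add_hook :: "nat \<Rightarrow> nat \<Rightarrow> nat list \<Rightarrow> nat list" where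
  "add_hook a m l = Suc a # map Suc l @ replicate (m - length l) 1"

section \<open>Monotonicity of parts and bounds on the diagonal\<close>

lemma part_antimono:
  assumes "is_partition l" "1 \<le> i" "i \<le> j"
  shows "part l j \<le> part l i"
proof (cases "j \<le> length l \<and> i < j")
  case True
  then have "l ! (j - 1) \<le> l ! (i - 1)"
    using assms by (auto simp: is_partition_def intro!: sorted_wrt_nth_less[of "(\<ge>)"])
  with True assms show ?thesis by (auto simp: part_def)
next
  case False
  with assms show ?thesis by (cases "i = j") (auto simp: part_def)
qed

lemma diag_index_bounds:
  assumes "is_partition l" "1 \<le> i" "i \<le> part l i"
  shows "i \<le> length l" "i \<le> part l 1"
proof -
  show "i \<le> length l"
    using assms by (auto simp: part_def split: if_splits)
  show "i \<le> part l 1"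
    using assms part_antimono[of l 1 i] by linarith
qed

lemma finite_diag: "finite {i. 1 \<le> i \<and> i \<le> part l i}"
  by (rule finite_subset[of _ "{..length l}"]) (auto simp: part_def split: if_splits)

lemma diag_length_le:
  assumes "is_partition l"
  shows "diag_length l \<le> length l" "diag_length l \<le> part l 1"
proof -
  have "{i. 1 \<le> i \<and> i \<le> part l i} \<subseteq> {1..length l}"
    "{i. 1 \<le> i \<and> i \<le> part l i} \<subseteq> {1..part l 1}"
    using diag_index_bounds[OF assms] by auto
  from this[THEN card_mono[rotated]]
  show "diag_length l \<le> length l" "diag_length l \<le> part l 1"
    by (auto simp: diag_length_def)
qed

lemma conj_part_le_length: "conj_part l j \<le> length l"
proof -
  have "card {i. 1 \<le> i \<and> i \<le> length l \<and> j \<le> part l i} \<le> card {1..length l}"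
    by (rule card_mono) auto
  then show ?thesis by (simp add: conj_part_def)
qed

section \<open>Effect of a new outer hook on parts, arms, legs and size\<close>

lemma is_partition_add_hook:
  assumes "is_partition l" "length l \<le> m" "part l 1 \<le> a"
  shows "is_partition (add_hook a m l)"
proof -
  have le: "x \<le> a" if x: "x \<in> set l" for x
  proof -
    obtain i where "i < length l" "x = l ! i"
      using x by (auto simp: in_set_conv_nth)
    then have "x = part l (Suc i)" by (simp add: part_def)
    then show ?thesis using part_antimono[OF assms(1), of 1 "Suc i"] assms(3) by simp
  qed
  show ?thesis
    using assms le by (auto simp: is_partition_def add_hook_def sorted_wrt_append sorted_wrt_map
        sorted_wrt_iff_nth_less[of _ "replicate _ _"])
qed

lemma length_add_hook: "length l \<le> m \<Longrightarrow> length (add_hook a m l) = Suc m"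
  by (simp add: add_hook_def)

lemma part_add_hook_1: "part (add_hook a m l) (Suc 0) = Suc a"
  by (simp add: part_def add_hook_def)

lemma part_add_hook_Suc:
  assumes "length l \<le> m" "1 \<le> i"
  shows "part (add_hook a m l) (Suc i) = (if i \<le> m then Suc (part l i) else 0)"
  using assms by (cases i) (auto simp: part_def add_hook_def nth_append)

lemma conj_part_add_hook_1:
  assumes "is_partition l" "length l \<le> m"
  shows "conj_part (add_hook a m l) (Suc 0) = Suc m"
proof -
  have "1 \<le> part (add_hook a m l) i" if "1 \<le> i" "i \<le> Suc m" for i
    using that assms part_add_hook_1[of a m l] part_add_hook_Suc[of l m "i - 1" a]
    by (cases "i = 1") auto
  then have "{i. 1 \<le> i \<and> i \<le> length (add_hook a m l) \<and> Suc 0 \<le> part (add_hook a m l) i} = {1..Suc m}"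
    unfolding length_add_hook[OF assms(2)] by fastforce
  then show ?thesis by (simp add: conj_part_def)
qed

text \<open>The bound \<open>j \<le> a\<close> makes the new first row reach column
  \<open>Suc j\<close>, so it adds one to the count. The appended parts 1 stay in the first column
  and are never counted here.\<close>

lemma conj_part_add_hook_Suc:
  assumes "length l \<le> m" "1 \<le> j" "j \<le> a"
  shows "conj_part (add_hook a m l) (Suc j) = Suc (conj_part l j)"
proof -
  let ?S = "{i. 1 \<le> i \<and> i \<le> length l \<and> j \<le> part l i}"
  have "{i. 1 \<le> i \<and> i \<le> length (add_hook a m l) \<and> Suc j \<le> part (add_hook a m l) i}
      = insert 1 (Suc ` ?S)" (is "?L = ?R")
  proof (rule set_eqI)
    fix i
    show "i \<in> ?L \<longleftrightarrow> i \<in> ?R"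
    proof (cases "i \<le> 1")
      case True
      then show ?thesis using assms
        by (cases "i = 1") (auto simp: length_add_hook part_add_hook_1)
    next
      case False
      then obtain i' where i': "i = Suc i'" "1 \<le> i'" by (cases i) auto
      with assms show ?thesis
        by (auto simp: length_add_hook part_add_hook_Suc) (auto simp: part_def split: if_splits)
    qed
  qed
  moreover have "card (insert 1 (Suc ` ?S)) = Suc (card ?S)"
    by (subst card_insert_disjoint) (auto simp: card_image)
  ultimately show ?thesis by (simp add: conj_part_def)
qed

lemma diag_length_add_hook:
  assumes "length l \<le> m"
  shows "diag_length (add_hook a m l) = Suc (diag_length l)"
proof -
  let ?S = "{i. 1 \<le> i \<and> i \<le> part l i}"
  have "{i. 1 \<le> i \<and> i \<le> part (add_hook a m l) i} = insert 1 (Suc ` ?S)" (is "?L = ?R")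
  proof (rule set_eqI)
    fix i
    show "i \<in> ?L \<longleftrightarrow> i \<in> ?R"
    proof (cases "i \<le> 1")
      case True
      then show ?thesis by (cases "i = 1") (auto simp: part_add_hook_1)
    next
      case False
      then obtain i' where i': "i = Suc i'" "1 \<le> i'" by (cases i) auto
      with assms show ?thesis
        by (auto simp: part_add_hook_Suc) (auto simp: part_def split: if_splits)
    qed
  qed
  moreover have "card (insert 1 (Suc ` ?S)) = Suc (card ?S)"
    using finite_diag[of l] by (subst card_insert_disjoint) (auto simp: card_image)
  ultimately show ?thesis by (simp add: diag_length_def)
qed

lemma arm_set_image: "arm_set l = (\<lambda>i. part l i - i) ` {1..diag_length l}"
  by (auto simp: arm_set_def)

lemma leg_set_image: "leg_set l = (\<lambda>i. conj_part l i - i) ` {1..diag_length l}"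
  by (auto simp: leg_set_def)

lemma atLeastAtMost_Suc_decompose: "{1..Suc d} = insert 1 (Suc ` {1..d})"
  by (auto simp: image_Suc_atLeastAtMost)

lemma arm_set_add_hook:
  assumes "is_partition l" "length l \<le> m"
  shows "arm_set (add_hook a m l) = insert a (arm_set l)"
proof -
  have "arm_set (add_hook a m l) = insert a
      ((\<lambda>i. part (add_hook a m l) (Suc i) - Suc i) ` {1..diag_length l})"
    unfolding arm_set_image diag_length_add_hook[OF assms(2)] atLeastAtMost_Suc_decompose
    by (simp add: part_add_hook_1 image_image del: image_Suc_atLeastAtMost)
  \<comment> \<open>Diagonal indices are at most \<open>length l\<close>, hence at most
    \<open>m\<close>. So the first branch of \<open>part_add_hook_Suc\<close> applies, and the two
    shifts by one cancel.\<close>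
  also have "(\<lambda>i. part (add_hook a m l) (Suc i) - Suc i) ` {1..diag_length l} = arm_set l"
    unfolding arm_set_image using assms diag_length_le(1)[OF assms(1)]
    by (intro image_cong) (auto simp: part_add_hook_Suc)
  finally show ?thesis .
qed

lemma leg_set_add_hook:
  assumes "is_partition l" "length l \<le> m" "part l 1 \<le> a"
  shows "leg_set (add_hook a m l) = insert m (leg_set l)"
proof -
  have "leg_set (add_hook a m l) = insert m
      ((\<lambda>i. conj_part (add_hook a m l) (Suc i) - Suc i) ` {1..diag_length l})"
    unfolding leg_set_image diag_length_add_hook[OF assms(2)] atLeastAtMost_Suc_decompose
    using assms(1,2) by (simp add: conj_part_add_hook_1 image_image del: image_Suc_atLeastAtMost)
  also have "(\<lambda>i. conj_part (add_hook a m l) (Suc i) - Suc i) ` {1..diag_length l} = leg_set l"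
    unfolding leg_set_image using assms diag_length_le(2)[OF assms(1)]
    by (intro image_cong) (auto simp: conj_part_add_hook_Suc)
  finally show ?thesis .
qed

text \<open>Strictness comes from \<open>1 \<le> i\<close>, together with \<open>part l 1\<close>
  being positive as soon as the diagonal is nonempty. This bound and its analogue for legs make the
  arm and leg of an added hook strictly larger than all earlier ones.\<close>

lemma arm_set_less:
  assumes "is_partition l" "x \<in> arm_set l"
  shows "x < part l 1"
proof -
  obtain i where i: "1 \<le> i" "i \<le> diag_length l" "x = part l i - i"
    using assms by (auto simp: arm_set_def)
  then show ?thesis
    using part_antimono[of l 1 i] diag_length_le(2)[of l] assms by linarith
qed

lemma leg_set_less:
  assumes "is_partition l" "x \<in> leg_set l"
  shows "x < length l"
proof -
  obtain i where i: "1 \<le> i" "i \<le> diag_length l" "x = conj_part l i - i"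
    using assms by (auto simp: leg_set_def)
  then show ?thesis
    using conj_part_le_length[of l i] diag_length_le(1)[of l] assms by linarith
qed

lemma sum_list_add_hook:
  assumes "length l \<le> m"
  shows "sum_list (add_hook a m l) = a + m + 1 + sum_list l"
proof -
  have "sum_list (map Suc l) = length l + sum_list l"
    by (induction l) auto
  then show ?thesis using assms by (simp add: add_hook_def sum_list_replicate)
qed

section \<open>Peeling off the outer hook, and the resulting induction\<close>

lemma partition_cases [consumes 1, case_names Nil add_hook]:
  assumes "is_partition l"
  obtains "l = []"
  | a m l' where "l = add_hook a m l'" "is_partition l'" "length l' \<le> m" "part l' 1 \<le> a"
proof (cases l)
  case Nil
  then show ?thesis using that by blast
next
  case (Cons x xs)
  \<comment> \<open>Parts equal to 1 lie wholly in the first column and disappear with it; every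
    larger remaining part loses one cell. The lost ones are restored by the \<open>replicate\<close>
    block, since the first leg is \<open>length xs\<close>.\<close>
  define l' where "l' = map (\<lambda>z. z - 1) (filter (\<lambda>z. 1 < z) xs)"
  have xs: "sorted_wrt (\<ge>) xs" "0 \<notin> set xs" and x: "0 < x" "\<forall>z\<in>set xs. z \<le> x"
    using assms Cons by (auto simp: is_partition_def)
  have split: "xs = map Suc l' @ replicate (length xs - length l') 1"
    using xs unfolding l'_def
  proof (induction xs)
    case (Cons z zs)
    show ?case
    proof (cases "1 < z")
      case True
      with Cons show ?thesis by auto
    next
      case False
      \<comment> \<open>From the first 1 onwards, weak decrease and positivity force every part to
        be 1.\<close>
      with Cons.prems have "z = 1" by (cases z) auto
      have "w = 1" if "w \<in> set zs" for w
      proof -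
        have "w \<le> z" "w \<noteq> 0" using Cons.prems that by (simp, metis list.set_intros(2))
        with \<open>z = 1\<close> show ?thesis by simp
      qed
      then have "\<forall>w\<in>set zs. w = 1" by blast
      then have "filter (\<lambda>z. 1 < z) zs = []" by (auto simp: filter_empty_conv)
      moreover have "zs = replicate (length zs) 1"
        using \<open>\<forall>w\<in>set zs. w = 1\<close> by (induction zs) auto
      ultimately show ?thesis using \<open>z = 1\<close> by simp
    qed
  qed simp
  have len: "length l' \<le> length xs" by (simp add: l'_def)
  have "sorted_wrt (\<ge>) (filter (\<lambda>z. 1 < z) xs)"
    using xs(1) by (rule sorted_wrt_filter)
  then have "is_partition l'"
    unfolding is_partition_def l'_def
    by (auto simp: sorted_wrt_map intro: sorted_wrt_mono_rel[rotated])
  moreover have "part l' 1 \<le> x - 1"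
  proof (cases "l' = []")
    case False
    then have "l' ! 0 \<in> set l'" by simp
    then show ?thesis using x(2) False by (auto simp: part_def l'_def)
  qed (simp add: part_def)
  moreover have "l = add_hook (x - 1) (length xs) l'"
    using Cons split x(1) by (simp add: add_hook_def)
  ultimately show ?thesis using that(2) len by blast
qed

lemma partition_induct [consumes 1, case_names Nil add_hook]:
  assumes "is_partition l" "P []"
    and "\<And>a m l. is_partition l \<Longrightarrow> length l \<le> m \<Longrightarrow> part l 1 \<le> a \<Longrightarrow> P l \<Longrightarrow> P (add_hook a m l)"
  shows "P l"
  using assms(1)
proof (induction "length l + sum_list l" arbitrary: l rule: less_induct)
  case less
  from less.prems show ?case
  proof (cases l rule: partition_cases)
    case (add_hook a m l')
    then show ?thesis using less.hyps[of l'] assms(3)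
      by (simp add: length_add_hook sum_list_add_hook)
  qed (simp add: assms(2))
qed

section \<open>Arm and leg sets as complete coordinates of a partition\<close>

lemma arm_leg_set_Nil: "arm_set [] = {}" "leg_set [] = {}"
proof -
  have "diag_length [] = 0" by (simp add: diag_length_def part_def)
  then show "arm_set [] = {}" "leg_set [] = {}" by (auto simp: arm_set_def leg_set_def)
qed

lemma finite_arm_leg_set: "finite (arm_set l)" "finite (leg_set l)"
  by (simp_all add: arm_set_image leg_set_image)

lemma add_hook_not_mem:
  assumes "is_partition l" "length l \<le> m" "part l 1 \<le> a"
  shows "a \<notin> arm_set l" "m \<notin> leg_set l"
  using arm_set_less[OF assms(1), of a] leg_set_less[OF assms(1), of m] assms(2,3) by auto

lemma Max_arm_leg_set_add_hook:
  assumes "is_partition l" "length l \<le> m" "part l 1 \<le> a"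
  shows "Max (arm_set (add_hook a m l)) = a" "Max (leg_set (add_hook a m l)) = m"
proof -
  have "x \<le> a" if "x \<in> arm_set l" for x
    using arm_set_less[OF assms(1) that] assms(3) by linarith
  then show "Max (arm_set (add_hook a m l)) = a"
    unfolding arm_set_add_hook[OF assms(1,2)]
    by (intro Max_eqI) (auto simp: finite_arm_leg_set)
  have "x \<le> m" if "x \<in> leg_set l" for x
    using leg_set_less[OF assms(1) that] assms(2) by linarith
  then show "Max (leg_set (add_hook a m l)) = m"
    unfolding leg_set_add_hook[OF assms]
    by (intro Max_eqI) (auto simp: finite_arm_leg_set)
qed

text \<open>The diagram is the disjoint union of its diagonal hooks, each with arm + leg + 1 cells.
  The cardinality of the leg set counts the diagonal cells.\<close>

lemma sum_list_partition:
  assumes "is_partition l"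
  shows "sum_list l = \<Sum>(arm_set l) + \<Sum>(leg_set l) + card (leg_set l)"
  using assms
proof (induction rule: partition_induct)
  case Nil
  then show ?case by (simp add: arm_leg_set_Nil)
next
  case (add_hook a m l)
  then show ?case using add_hook_not_mem[of l m a]
    by (simp add: arm_set_add_hook leg_set_add_hook sum_list_add_hook finite_arm_leg_set)
qed

text \<open>The outer hook can be read off as the maxima of the two sets. Since these do not occur
  among the inner arms and legs, deleting them leaves the data of the inner partitions.\<close>

lemma partition_eqI:
  assumes "is_partition l" "is_partition l'" "arm_set l = arm_set l'" "leg_set l = leg_set l'"
  shows "l = l'"
  using assms
proof (induction arbitrary: l' rule: partition_induct)
  case Nil
  from Nil(1) show ?case
    by (cases rule: partition_cases) (use Nil in \<open>auto simp: arm_leg_set_Nil arm_set_add_hook\<close>)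
next
  case (add_hook a m l)
  from add_hook.prems(1) show ?case
  proof (cases rule: partition_cases)
    case Nil
    with add_hook show ?thesis by (simp add: arm_leg_set_Nil arm_set_add_hook)
  next
    case (add_hook a' m' k)
    note k = this
    note l = \<open>is_partition l\<close> \<open>length l \<le> m\<close> \<open>part l 1 \<le> a\<close>
    have "a = a'" "m = m'"
      using Max_arm_leg_set_add_hook[OF l] Max_arm_leg_set_add_hook[OF k(2-4)] add_hook.prems k(1)
      by simp_all
    moreover have "arm_set l = arm_set k" "leg_set l = leg_set k"
      using add_hook.prems(2,3) add_hook_not_mem[OF l] add_hook_not_mem[OF k(2-4)] l k
        \<open>a = a'\<close> \<open>m = m'\<close>
      by (auto simp: arm_set_add_hook leg_set_add_hook insert_ident)
    ultimately show ?thesis using add_hook.IH[OF k(2)] k(1) by simp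
  qed
qed

text \<open>The maxima of \<open>A\<close> and \<open>L\<close> become the outer hook, placed around
  a partition realizing the remaining elements.\<close>

lemma partition_exists:
  assumes "finite A" "finite L" "card A = card L"
  shows "\<exists>l. is_partition l \<and> arm_set l = A \<and> leg_set l = L"
  using assms
proof (induction "card A" arbitrary: A L)
  case 0
  then show ?case
    by (intro exI[of _ "[]"]) (simp add: is_partition_def arm_leg_set_Nil)
next
  case (Suc s)
  define a m where "a = Max A" and "m = Max L"
  have ne: "A \<noteq> {}" "L \<noteq> {}" using Suc by auto
  then have mem: "a \<in> A" "m \<in> L" using Suc.prems by (simp_all add: a_def m_def)
  have "s = card (A - {a})" "card (A - {a}) = card (L - {m})"
    using Suc.hyps(2) Suc.prems mem by simp_all
  then obtain l where l: "is_partition l" "arm_set l = A - {a}" "leg_set l = L - {m}"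
    using Suc.hyps(1)[of "A - {a}" "L - {m}"] Suc.prems by blast
  \<comment> \<open>The hook fits around \<open>l\<close>: the outer arm and leg of \<open>l\<close>
    are elements other than the maxima, so they are strictly smaller, which absorbs the extra 1 in
    \<open>Suc a'\<close> and \<open>Suc m'\<close>.\<close>
  have "part l 1 \<le> a \<and> length l \<le> m"
    using l(1)
  proof (cases rule: partition_cases)
    case Nil
    then show ?thesis by (simp add: part_def)
  next
    case (add_hook a' m' l')
    then have "a' \<in> A - {a}" "m' \<in> L - {m}"
      using l by (auto simp: arm_set_add_hook leg_set_add_hook)
    then have "a' < a" "m' < m"
      using Max_ge[OF Suc.prems(1), of a'] Max_ge[OF Suc.prems(2), of m']
      unfolding a_def[symmetric] m_def[symmetric] by auto
    then show ?thesis using add_hook by (simp add: part_add_hook_1 length_add_hook)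
  qed
  then show ?case
    using l mem
    by (intro exI[of _ "add_hook a m l"])
      (auto simp: is_partition_add_hook arm_set_add_hook leg_set_add_hook)
qed

section \<open>The size of a core\<close>

text \<open>Division with remainder by \<open>t\<close> recovers both indices. A general
  \<open>\<sigma>\<close> covers the arms, with the identity, and the legs, with the reversal of
  residues.\<close>

lemma inj_on_residues:
  fixes t :: nat and N :: "nat \<Rightarrow> nat"
  assumes "\<And>j. j < t \<Longrightarrow> \<sigma> j < t" "inj_on \<sigma> {..<t}"
  shows "inj_on (\<lambda>(j, r). r * t + \<sigma> j) (SIGMA j:{..<t}. {..<N j})"
proof (rule inj_onI, clarsimp)
  fix j r j' r'
  assume *: "j < t" "j' < t" "r * t + \<sigma> j = r' * t + \<sigma> j'"
  have "\<sigma> j = (r * t + \<sigma> j) mod t" using assms(1) *(1) by simp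
  also have "\<dots> = \<sigma> j'" unfolding *(3) using assms(1) *(2) by simp
  finally have "\<sigma> j = \<sigma> j'" .
  then show "j = j' \<and> r = r'"
    using * assms(2) by (auto dest: inj_onD)
qed

lemma
  fixes t :: nat and N :: "nat \<Rightarrow> nat"
  assumes "\<And>j. j < t \<Longrightarrow> \<sigma> j < t" "inj_on \<sigma> {..<t}"
  defines "S \<equiv> (\<lambda>(j, r). r * t + \<sigma> j) ` (SIGMA j:{..<t}. {..<N j})"
  shows card_residues: "card S = (\<Sum>j<t. N j)"
    and sum_residues: "2 * int (\<Sum>S) =
      (\<Sum>j<t. int t * int (N j) * (int (N j) - 1) + 2 * int (\<sigma> j) * int (N j))"
proof -
  note inj = inj_on_residues[OF assms(1,2), of N]
  show "card S = (\<Sum>j<t. N j)"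
    using inj by (simp add: S_def card_image)
  \<comment> \<open>Doubling avoids halving triangular numbers. Integers are used because the factor
    \<open>int M - 1\<close> is -1 for the empty progression.\<close>
  have tri: "2 * (\<Sum>r<M. int r * b + d) = b * int M * (int M - 1) + 2 * d * int M" for M b d
    by (induction M) (simp_all add: algebra_simps)
  have "int (\<Sum>S) = (\<Sum>j<t. \<Sum>r<N j. int r * int t + int (\<sigma> j))"
    using inj by (simp add: S_def sum.reindex sum.Sigma split_def)
  then show "2 * int (\<Sum>S) =
      (\<Sum>j<t. int t * int (N j) * (int (N j) - 1) + 2 * int (\<sigma> j) * int (N j))"
    by (simp add: sum_distrib_left[of 2 _ "{..<t}"] tri del: of_nat_sum)
qed

lemma size_core_partition:
  assumes "sum_list c = 0"
  shows "2 * int (sum_list (core_partition c)) =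
    (\<Sum>j<length c. int (length c) * (c ! j)\<^sup>2 + 2 * int j * c ! j)"
proof -
  define t where "t = length c"
  define A where "A = {r * t + j | r j. j < t \<and> int r < c ! j}"
  define L where "L = {r * t + t - j - 1 | r j. j < t \<and> int r < - (c ! j)}"
  let ?P = "\<lambda>j. nat (c ! j)" and ?N = "\<lambda>j. nat (- (c ! j))" and ?\<tau> = "\<lambda>j. t - 1 - j"
  have A: "A = (\<lambda>(j, r). r * t + j) ` (SIGMA j:{..<t}. {..<?P j})"
    by (force simp: A_def image_iff)
  have L: "L = (\<lambda>(j, r). r * t + ?\<tau> j) ` (SIGMA j:{..<t}. {..<?N j})"
    by (force simp: L_def image_iff)
  have \<tau>: "?\<tau> j < t" if "j < t" for j using that by simp
  have inj: "inj_on ?\<tau> {..<t}" by (auto simp: inj_on_def)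
  have cA: "card A = (\<Sum>j<t. ?P j)" unfolding A by (rule card_residues) auto
  have cL: "card L = (\<Sum>j<t. ?N j)" unfolding L by (rule card_residues[OF \<tau> inj])
  have c0: "(\<Sum>j<t. c ! j) = 0"
    using assms by (simp add: sum_list_sum_nth t_def atLeast0LessThan)
  \<comment> \<open>Positive coordinates feed only \<open>A\<close> and negative ones only
    \<open>L\<close>, so the difference of cardinalities is the coordinate sum.\<close>
  have "int (card A) - int (card L) = (\<Sum>j<t. int (?P j) - int (?N j))"
    by (simp add: cA cL sum_subtractf)
  also have "\<dots> = (\<Sum>j<t. c ! j)" by (rule sum.cong) auto
  finally have "card A = card L" using c0 by simp
  moreover have "finite A" "finite L" by (simp_all add: A L)
  ultimately obtain l where l: "is_partition l" "arm_set l = A" "leg_set l = L"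
    using partition_exists by blast
  have "core_partition c = l"
    unfolding core_partition_def Let_def t_def[symmetric] A_def[symmetric] L_def[symmetric]
    using l by (intro the_equality) (auto intro: partition_eqI)
  then have "2 * int (sum_list (core_partition c)) = 2 * int (\<Sum>A) + 2 * int (\<Sum>L) + 2 * int (card L)"
    using sum_list_partition[OF l(1)] l by simp
  also have "2 * int (\<Sum>A) =
      (\<Sum>j<t. int t * int (?P j) * (int (?P j) - 1) + 2 * int j * int (?P j))"
    unfolding A by (rule sum_residues) auto
  also have "2 * int (\<Sum>L) =
      (\<Sum>j<t. int t * int (?N j) * (int (?N j) - 1) + 2 * int (?\<tau> j) * int (?N j))"
    unfolding L by (rule sum_residues[OF \<tau> inj])
  also have "2 * int (card L) = (\<Sum>j<t. 2 * int (?N j))"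
    by (simp add: cL sum_distrib_left)
  \<comment> \<open>In each coordinate one of the two \<open>nat\<close> truncations is 0. For a
    negative coordinate, the reversed residue and the diagonal term combine to give the same
    polynomial as in the positive case. The common extra term \<open>- int t * c ! j\<close>
    vanishes on summation.\<close>
  also have "(\<Sum>j<t. int t * int (?P j) * (int (?P j) - 1) + 2 * int j * int (?P j))
      + (\<Sum>j<t. int t * int (?N j) * (int (?N j) - 1) + 2 * int (?\<tau> j) * int (?N j))
      + (\<Sum>j<t. 2 * int (?N j))
    = (\<Sum>j<t. int t * (c ! j)\<^sup>2 + 2 * int j * c ! j - int t * c ! j)"
    unfolding sum.distrib[symmetric]
  proof (rule sum.cong)
    fix j assume "j \<in> {..<t}"
    then have "int (?\<tau> j) = int t - 1 - int j" by auto
    then show "int t * int (?P j) * (int (?P j) - 1) + 2 * int j * int (?P j)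
      + (int t * int (?N j) * (int (?N j) - 1) + 2 * int (?\<tau> j) * int (?N j)) + 2 * int (?N j)
      = int t * (c ! j)\<^sup>2 + 2 * int j * c ! j - int t * c ! j"
      by (cases "c ! j \<ge> 0") (simp_all add: algebra_simps power2_eq_square)
  qed simp
  also have "\<dots> = (\<Sum>j<t. int t * (c ! j)\<^sup>2 + 2 * int j * c ! j)"
    using c0 by (simp add: sum_subtractf sum_distrib_left[symmetric])
  finally show ?thesis by (simp add: t_def)
qed

section \<open>The quadratic form of 3-cores and the map between them\<close>

lemma core_vectors_3_iff:
  "[- x - y, x, y] \<in> core_vectors 3 n \<longleftrightarrow> int n = 3 * (x\<^sup>2 + x * y + y\<^sup>2) + x + 2 * y"
proof -
  have "2 * int (sum_list (core_partition [- x - y, x, y])) =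
      2 * (3 * (x\<^sup>2 + x * y + y\<^sup>2) + x + 2 * y)"
    by (subst size_core_partition)
      (simp_all add: numeral_3_eq_3 lessThan_Suc power2_eq_square algebra_simps)
  then show ?thesis by (auto simp: core_vectors_def)
qed

theorem theorem5p1:
  fixes n k q :: nat and \<epsilon> :: int
  assumes "k > 0"
    and "k mod 3 \<noteq> 0"
    and "\<epsilon> \<in> {-1, 1}"
    and "int k = 3 * int q + \<epsilon>"
  shows "phi k q \<epsilon> \<in> core_vectors 3 n \<rightarrow> core_vectors 3 (k\<^sup>2 * n + (k\<^sup>2 - 1) div 3)
    \<and> inj_on (phi k q \<epsilon>) (core_vectors 3 n)"
proof
  have \<epsilon>: "\<epsilon> * \<epsilon> = 1" "\<epsilon> \<noteq> 0" using assms(3) by auto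
  \<comment> \<open>Positivity of \<open>k\<close> prevents truncation in
    \<open>k\<^sup>2 - 1\<close>, and divisibility by 3 makes the division exact.\<close>
  have "int (3 * ((k\<^sup>2 - 1) div 3)) = (int k)\<^sup>2 - 1"
    using three_dvd_square_minus_1[OF assms(2)] assms(1) by simp
  also have "\<dots> = 3 * (3 * (int q)\<^sup>2 + 2 * \<epsilon> * int q)"
    using \<epsilon> by (simp add: assms(4) power2_eq_square algebra_simps)
  finally have shift: "int ((k\<^sup>2 - 1) div 3) = 3 * (int q)\<^sup>2 + 2 * \<epsilon> * int q" by simp
  show "phi k q \<epsilon> \<in> core_vectors 3 n \<rightarrow> core_vectors 3 (k\<^sup>2 * n + (k\<^sup>2 - 1) div 3)"
  proof
    fix c assume c: "c \<in> core_vectors 3 n"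
    then obtain x y where xy: "c = [- x - y, x, y]"
      using core_vectors_3_form by blast
    define X Y where "X = \<epsilon> * int k * x" and "Y = \<epsilon> * (int k * y + int q)"
    have phi: "phi k q \<epsilon> c = [- X - Y, X, Y]"
      by (simp add: xy phi_eq X_def Y_def algebra_simps)
    have n: "int n = 3 * (x\<^sup>2 + x * y + y\<^sup>2) + x + 2 * y"
      using c core_vectors_3_iff xy by blast
    \<comment> \<open>The quadratic part carries \<open>\<epsilon> * \<epsilon>\<close>, which is 1,
      and the linear part a single \<open>\<epsilon>\<close>. The shift by \<open>q\<close> is
      chosen so that the coefficient of \<open>int k * (x + 2 * y)\<close> becomes
      \<open>3 * int q + \<epsilon>\<close>, which is \<open>k\<close> again; thus the form is
      scaled by the square of \<open>k\<close> up to a constant.\<close>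
    have "3 * (X\<^sup>2 + X * Y + Y\<^sup>2) + X + 2 * Y =
        (\<epsilon> * \<epsilon>) * 3 * ((int k)\<^sup>2 * (x\<^sup>2 + x * y + y\<^sup>2) + int k * int q * (x + 2 * y) + (int q)\<^sup>2)
        + \<epsilon> * (int k * (x + 2 * y) + 2 * int q)"
      by (simp add: X_def Y_def power2_eq_square algebra_simps)
    also have "\<dots> = (int k)\<^sup>2 * 3 * (x\<^sup>2 + x * y + y\<^sup>2) + int k * (3 * int q + \<epsilon>) * (x + 2 * y)
        + 3 * (int q)\<^sup>2 + 2 * \<epsilon> * int q"
      unfolding \<epsilon>(1) by (simp add: algebra_simps)
    also have "\<dots> = int (k\<^sup>2 * n + (k\<^sup>2 - 1) div 3)"
      unfolding assms(4)[symmetric] of_nat_add shift of_nat_mult n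
      by (simp add: power2_eq_square algebra_simps)
    finally show "phi k q \<epsilon> c \<in> core_vectors 3 (k\<^sup>2 * n + (k\<^sup>2 - 1) div 3)"
      unfolding phi core_vectors_3_iff by simp
  qed
  show "inj_on (phi k q \<epsilon>) (core_vectors 3 n)"
  proof (rule inj_onI)
    fix c d assume c: "c \<in> core_vectors 3 n" and d: "d \<in> core_vectors 3 n"
      and eq: "phi k q \<epsilon> c = phi k q \<epsilon> d"
    obtain x y where "c = [- x - y, x, y]" using core_vectors_3_form[OF c] by blast
    moreover obtain u v where "d = [- u - v, u, v]" using core_vectors_3_form[OF d] by blast
    \<comment> \<open>The last two coordinates are affine in \<open>x\<close> and \<open>y\<close>
      with nonzero slope \<open>\<epsilon> * int k\<close>.\<close>
    ultimately show "c = d" using eq assms(1) \<epsilon>(2) by (simp add: phi_eq)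
  qed
qed

end
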